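(* Let $\mathcal I$ be a proper ideal on $\mathbb N$. The following statements are equivalent: (1) $\mathcal I$ is at most $\omega$-maximal. (2) There is a Banach lattice isomorphism from $\ell_\infty/c_{0,\mathcal I}$ onto a closed sublattice of $\ell_\infty$. (3) There exists a bounded linear operator $Q\colon\ell_\infty\to\ell_\infty$ with $\ker Q=c_{0,\mathcal I}$ such that for every pair of subsets $A,B\subseteq\mathbb N$ and every $n\in\mathbb N$, $$Q(\chi_A)_n\neq 0\ \text{ and }\ Q(\chi_B)_n\neq 0\ \Longrightarrow\ Q(\chi_{A\cap B})_n\neq 0.$$
   Context: An ideal on a set $X$ is a family of subsets of $X$ containing $\emptyset$ and closed under subsets and finite unions; every ideal is assumed to contain all finite subsets of $X$. An ideal is proper if it is not $\mathcal P(X)$. A maximal ideal is a proper ideal whose only proper extension (as an ideal) is $\mathcal P(X)$. An ideal $\mathcal I$ on $\mathbb N$ is at most $\omega$-maximal if it is the intersection of a nonempty, at most countable (finite or countably infinite) family of maximal ideals on $\mathbb N$. $\ell_\infty$ is the real Banach lattice of bounded real sequences with supremum norm and coordinatewise order. $c_{0,\mathcal I}$ is the closed subspace (and lattice ideal) of all $(x_n)\in\ell_\infty$ such that $\{n\in\mathbb N:|x_n|\ge\varepsilon\}\in\mathcal I$ for every $\varepsilon>0$; $\ell_\infty/c_{0,\mathcal I}$ carries the quotient Banach lattice structure. A Banach lattice homomorphism is a bounded linear operator $T$ with $T(x\vee y)=Tx\vee Ty$; a Banach lattice isomorphism is a bijective Banach lattice homomorphism between Banach lattices. $\chi_A$ is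 the characteristic function of $A$ and $x_n$ denotes the $n$-th coordinate of $x\in\ell_\infty$. *)

theory Defs
  imports "HOL-Analysis.Analysis"
begin

section \<open>Ideals of sets\<close>

definition set_ideal :: "'a set set \<Rightarrow> bool" where
  "set_ideal I \<longleftrightarrow>
     {} \<in> I \<and>
     (\<forall>A\<in>I. \<forall>B. B \<subseteq> A \<longrightarrow> B \<in> I) \<and>
     (\<forall>A\<in>I. \<forall>B\<in>I. A \<union> B \<in> I) \<and>
     (\<forall>A. finite A \<longrightarrow> A \<in> I)"

definition proper_ideal :: "'a set set \<Rightarrow> bool" where
  "proper_ideal I \<longleftrightarrow> set_ideal I \<and> I \<noteq> UNIV"

definition maximal_set_ideal :: "'a set set \<Rightarrow> bool" where
  "maximal_set_ideal I \<longleftrightarrow>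
     proper_ideal I \<and> (\<forall>J. set_ideal J \<and> I \<subset> J \<longrightarrow> J = UNIV)"

definition at_most_omega_maximal :: "nat set set \<Rightarrow> bool" where
  "at_most_omega_maximal I \<longleftrightarrow>
     (\<exists>\<M>. \<M> \<noteq> {} \<and> countable \<M> \<and> (\<forall>M\<in>\<M>. maximal_set_ideal M) \<and> I = \<Inter>\<M>)"


section \<open>The Banach lattice of bounded sequences\<close>

text \<open>
  Since \<^typ>\<open>nat\<close> carries the discrete topology, bounded continuous functions on it are exactly the
  bounded sequences, and the library norm is the supremum norm.
\<close>

type_synonym linf = "nat \<Rightarrow>\<^sub>C real"

lemma sup_bcontfun_closed:
  fixes f g :: "'a::topological_space \<Rightarrow> 'b::ordered_euclidean_space"
  assumes "f \<in> bcontfun" "g \<in> bcontfun"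
  shows "(\<lambda>x. sup (f x) (g x)) \<in> bcontfun" "(\<lambda>x. inf (f x) (g x)) \<in> bcontfun"
proof -
  from assms have c: "continuous_on UNIV f" "continuous_on UNIV g"
    and b: "bounded (range f \<union> range g)"
    by (auto simp: bcontfun_def)
  from bounded_subset_cbox_symmetric[OF b] obtain a where "range f \<union> range g \<subseteq> cbox (-a) a"
    by blast
  then have fg: "- a \<le> f x" "f x \<le> a" "- a \<le> g x" "g x \<le> a" for x
    by (auto simp: cbox_interval image_subset_iff)
  then have "- a \<le> sup (f x) (g x)" "sup (f x) (g x) \<le> a"
    "- a \<le> inf (f x) (g x)" "inf (f x) (g x) \<le> a" for x
    by (meson le_supI le_supI1 le_infI le_infI1)+
  then have "range (\<lambda>x. sup (f x) (g x)) \<subseteq> cbox (-a) a" "range (\<lambda>x. inf (f x) (g x)) \<subseteq> cbox (-a) a"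
    by (auto simp: cbox_interval)
  then have "bounded (range (\<lambda>x. sup (f x) (g x)))" "bounded (range (\<lambda>x. inf (f x) (g x)))"
    using bounded_cbox bounded_subset by blast+
  with c show "(\<lambda>x. sup (f x) (g x)) \<in> bcontfun" "(\<lambda>x. inf (f x) (g x)) \<in> bcontfun"
    by (auto simp: bcontfun_def continuous_on_def intro: tendsto_sup tendsto_inf)
qed

unbundle bcontfun.lifting

instantiation bcontfun :: (topological_space, ordered_euclidean_space) lattice
begin

lift_definition less_eq_bcontfun :: "'a \<Rightarrow>\<^sub>C 'b \<Rightarrow> 'a \<Rightarrow>\<^sub>C 'b \<Rightarrow> bool" is "\<lambda>f g. \<forall>x. f x \<le> g x" .

definition less_bcontfun :: "'a \<Rightarrow>\<^sub>C 'b \<Rightarrow> 'a \<Rightarrow>\<^sub>C 'b \<Rightarrow> bool" where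
  "less_bcontfun f g \<longleftrightarrow> f \<le> g \<and> \<not> g \<le> f"

lift_definition sup_bcontfun :: "'a \<Rightarrow>\<^sub>C 'b \<Rightarrow> 'a \<Rightarrow>\<^sub>C 'b \<Rightarrow> 'a \<Rightarrow>\<^sub>C 'b" is "\<lambda>f g x. sup (f x) (g x)"
  by (rule sup_bcontfun_closed)

lift_definition inf_bcontfun :: "'a \<Rightarrow>\<^sub>C 'b \<Rightarrow> 'a \<Rightarrow>\<^sub>C 'b \<Rightarrow> 'a \<Rightarrow>\<^sub>C 'b" is "\<lambda>f g x. inf (f x) (g x)"
  by (rule sup_bcontfun_closed)

instance
proof
  fix f g h :: "'a \<Rightarrow>\<^sub>C 'b"
  show "f < g \<longleftrightarrow> f \<le> g \<and> \<not> g \<le> f" by (rule less_bcontfun_def)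
  show "f \<le> f" by transfer simp
  show "f \<le> g \<Longrightarrow> g \<le> h \<Longrightarrow> f \<le> h" by transfer (blast intro: order_trans)
  show "f \<le> g \<Longrightarrow> g \<le> f \<Longrightarrow> f = g" by transfer (blast intro: order_antisym)
  show "inf f g \<le> f" "inf f g \<le> g" "f \<le> sup f g" "g \<le> sup f g" by (transfer, simp)+
  show "f \<le> g \<Longrightarrow> f \<le> h \<Longrightarrow> f \<le> inf g h" by transfer simp
  show "g \<le> f \<Longrightarrow> h \<le> f \<Longrightarrow> sup g h \<le> f" by transfer simp
qed

end

lift_definition chi :: "nat set \<Rightarrow> linf" is "\<lambda>A n. indicator A n"
proof -
  fix A :: "nat set"
  have "range (indicator A :: nat \<Rightarrow> real) \<subseteq> {0, 1}"
    by (auto simp: indicator_def)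
  then have "bounded (range (indicator A :: nat \<Rightarrow> real))"
    by (rule bounded_subset[rotated]) simp
  then show "(\<lambda>n. indicator A n :: real) \<in> bcontfun"
    by (simp add: bcontfun_def)
qed

definition c0 :: "nat set set \<Rightarrow> linf set" where
  "c0 I = {x. \<forall>\<epsilon>>0. {n. \<epsilon> \<le> \<bar>apply_bcontfun x n\<bar>} \<in> I}"

definition closed_sublattice :: "linf set \<Rightarrow> bool" where
  "closed_sublattice S \<longleftrightarrow>
     subspace S \<and> closed S \<and> (\<forall>x\<in>S. \<forall>y\<in>S. sup x y \<in> S \<and> inf x y \<in> S)"


section \<open>Normed lattices on carrier sets\<close>

text \<open>
  The quotient depends on the ideal, so it is not a type, and Banach lattices are represented by
  explicit structures on carrier sets. The order is implicit: \<open>x \<le> y\<close> iff \<open>x \<or> y = y\<close>. The two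
  structures introduced below are Banach lattices, so no predicate for this is needed.
\<close>

record 'a normed_lattice =
  vcarrier :: "'a set"
  vadd :: "'a \<Rightarrow> 'a \<Rightarrow> 'a"
  vscale :: "real \<Rightarrow> 'a \<Rightarrow> 'a"
  vsup :: "'a \<Rightarrow> 'a \<Rightarrow> 'a"
  vnorm :: "'a \<Rightarrow> real"

definition lattice_homomorphism :: "'a normed_lattice \<Rightarrow> 'b normed_lattice \<Rightarrow> ('a \<Rightarrow> 'b) \<Rightarrow> bool" where
  "lattice_homomorphism E F T \<longleftrightarrow>
     T \<in> vcarrier E \<rightarrow> vcarrier F \<and>
     (\<forall>x\<in>vcarrier E. \<forall>y\<in>vcarrier E. T (vadd E x y) = vadd F (T x) (T y)) \<and>
     (\<forall>c. \<forall>x\<in>vcarrier E. T (vscale E c x) = vscale F c (T x)) \<and>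
     (\<exists>K. \<forall>x\<in>vcarrier E. vnorm F (T x) \<le> K * vnorm E x) \<and>
     (\<forall>x\<in>vcarrier E. \<forall>y\<in>vcarrier E. T (vsup E x y) = vsup F (T x) (T y))"

definition lattice_isomorphism :: "'a normed_lattice \<Rightarrow> 'b normed_lattice \<Rightarrow> ('a \<Rightarrow> 'b) \<Rightarrow> bool" where
  "lattice_isomorphism E F T \<longleftrightarrow>
     lattice_homomorphism E F T \<and> bij_betw T (vcarrier E) (vcarrier F)"

definition linf_on :: "linf set \<Rightarrow> linf normed_lattice" where
  "linf_on S = \<lparr>vcarrier = S, vadd = (+), vscale = (*\<^sub>R), vsup = sup, vnorm = norm\<rparr>"

definition c0_coset :: "nat set set \<Rightarrow> linf \<Rightarrow> linf set" where
  "c0_coset I x = {x + z |z. z \<in> c0 I}"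

text \<open>
  The operations of the quotient are those induced by representatives, see the lemmas below. In
  \<open>vscale\<close>, adding \<^term>\<open>c0 I\<close> only matters for the scalar \<open>0\<close>.
\<close>

definition linf_quotient :: "nat set set \<Rightarrow> linf set normed_lattice" where
  "linf_quotient I =
     \<lparr>vcarrier = range (c0_coset I),
      vadd = (\<lambda>X Y. {x + y |x y. x \<in> X \<and> y \<in> Y}),
      vscale = (\<lambda>c X. {c *\<^sub>R x + z |x z. x \<in> X \<and> z \<in> c0 I}),
      vsup = (\<lambda>X Y. {sup x y |x y. x \<in> X \<and> y \<in> Y}),
      vnorm = (\<lambda>X. INF x\<in>X. norm x)\<rparr>"

lemma bcontfun_simps [simp]:
  "apply_bcontfun (sup x y) n = sup (apply_bcontfun x n) (apply_bcontfun y n)"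
  "apply_bcontfun (inf x y) n = inf (apply_bcontfun x n) (apply_bcontfun y n)"
  for x y :: "'a::topological_space \<Rightarrow>\<^sub>C 'b::ordered_euclidean_space"
  by (transfer, simp)+

lemma c0_dominated:
  assumes I: "set_ideal I" and x: "x \<in> c0 I" and y: "y \<in> c0 I"
    and le: "\<And>n. \<bar>apply_bcontfun z n\<bar> \<le> C * (\<bar>apply_bcontfun x n\<bar> + \<bar>apply_bcontfun y n\<bar>)"
  shows "z \<in> c0 I"
  unfolding c0_def
proof (intro CollectI allI impI)
  fix e :: real assume e: "e > 0"
  define K where "K = \<bar>C\<bar> + 1"
  have K: "K > 0" by (simp add: K_def)
  define d where "d = e / (2 * K)"
  have d: "d > 0" using e K by (simp add: d_def)
  have "{n. e \<le> \<bar>apply_bcontfun z n\<bar>}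
      \<subseteq> {n. d \<le> \<bar>apply_bcontfun x n\<bar>} \<union> {n. d \<le> \<bar>apply_bcontfun y n\<bar>}"
  proof (rule subsetI, rule ccontr)
    fix n assume n: "n \<in> {n. e \<le> \<bar>apply_bcontfun z n\<bar>}"
      and nn: "n \<notin> {n. d \<le> \<bar>apply_bcontfun x n\<bar>} \<union> {n. d \<le> \<bar>apply_bcontfun y n\<bar>}"
    have "C * (\<bar>apply_bcontfun x n\<bar> + \<bar>apply_bcontfun y n\<bar>)
        \<le> K * (\<bar>apply_bcontfun x n\<bar> + \<bar>apply_bcontfun y n\<bar>)"
      by (rule mult_right_mono) (auto simp: K_def)
    also have "\<dots> < K * (d + d)"
      using nn K by (intro mult_strict_left_mono) auto
    also have "\<dots> = e" using K by (simp add: d_def field_simps)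
    finally show False using n le[of n] by simp
  qed
  moreover have "{n. d \<le> \<bar>apply_bcontfun x n\<bar>} \<union> {n. d \<le> \<bar>apply_bcontfun y n\<bar>} \<in> I"
    using I x y d by (auto simp: set_ideal_def c0_def)
  ultimately show "{n. e \<le> \<bar>apply_bcontfun z n\<bar>} \<in> I"
    using I unfolding set_ideal_def by blast
qed

lemma subspace_c0:
  assumes I: "set_ideal I" shows "subspace (c0 I)"
proof (rule subspaceI)
  show 0: "0 \<in> c0 I" using I by (auto simp: c0_def set_ideal_def)
  show "x + y \<in> c0 I" if "x \<in> c0 I" "y \<in> c0 I" for x y
    using I that by (rule c0_dominated[where C = 1]) auto
  show "c *\<^sub>R x \<in> c0 I" if "x \<in> c0 I" for c x
    using I that 0 by (rule c0_dominated[where C = "\<bar>c\<bar>"]) (auto simp: abs_mult)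
qed

context
  fixes I :: "nat set set"
  assumes I: "set_ideal I"
begin

lemma c0_coset_eq_iff: "c0_coset I x = c0_coset I y \<longleftrightarrow> x - y \<in> c0 I"
proof -
  have mem: "u \<in> c0_coset I v \<longleftrightarrow> u - v \<in> c0 I" for u v
    unfolding c0_coset_def by (auto intro: exI[of _ "u - v"])
  note S = subspace_c0[OF I]
  show ?thesis
  proof
    assume "c0_coset I x = c0_coset I y"
    moreover have "x \<in> c0_coset I x" using subspace_0[OF S] by (simp add: mem)
    ultimately show "x - y \<in> c0 I" by (simp add: mem)
  next
    assume xy: "x - y \<in> c0 I"
    have "u - x \<in> c0 I \<longleftrightarrow> u - y \<in> c0 I" for u
      using subspace_add[OF S _ xy, of "u - x"] subspace_diff[OF S _ xy, of "u - y"] by auto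
    then show "c0_coset I x = c0_coset I y" by (auto simp: mem)
  qed
qed

lemma linf_quotient_add:
  "vadd (linf_quotient I) (c0_coset I x) (c0_coset I y) = c0_coset I (x + y)" (is "?L = ?R")
proof
  note S = subspace_c0[OF I]
  show "?L \<subseteq> ?R"
  proof
    fix u assume "u \<in> ?L"
    then obtain a b where "a \<in> c0 I" "b \<in> c0 I" "u = (x + a) + (y + b)"
      by (auto simp: linf_quotient_def c0_coset_def)
    then show "u \<in> ?R" unfolding c0_coset_def
      by (auto intro!: exI[of _ "a + b"] subspace_add[OF S])
  qed
  show "?R \<subseteq> ?L"
  proof
    fix u assume "u \<in> ?R"
    then obtain a where "a \<in> c0 I" "u = (x + a) + (y + 0)"
      by (auto simp: c0_coset_def add_ac)
    then show "u \<in> ?L" using subspace_0[OF S]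
      unfolding linf_quotient_def c0_coset_def by (simp, metis)
  qed
qed

lemma linf_quotient_scale:
  "vscale (linf_quotient I) c (c0_coset I x) = c0_coset I (c *\<^sub>R x)" (is "?L = ?R")
proof
  note S = subspace_c0[OF I]
  show "?L \<subseteq> ?R"
  proof
    fix u assume "u \<in> ?L"
    then obtain a b where "a \<in> c0 I" "b \<in> c0 I" "u = c *\<^sub>R (x + a) + b"
      by (auto simp: linf_quotient_def c0_coset_def)
    then show "u \<in> ?R" unfolding c0_coset_def
      by (auto intro!: exI[of _ "c *\<^sub>R a + b"] subspace_add[OF S] subspace_scale[OF S]
          simp: scaleR_add_right)
  qed
  show "?R \<subseteq> ?L"
  proof
    fix u assume "u \<in> ?R"
    then obtain a where "a \<in> c0 I" "u = c *\<^sub>R (x + 0) + a"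
      by (auto simp: c0_coset_def)
    then show "u \<in> ?L" using subspace_0[OF S]
      unfolding linf_quotient_def c0_coset_def by (simp, metis)
  qed
qed

lemma linf_quotient_sup:
  "vsup (linf_quotient I) (c0_coset I x) (c0_coset I y) = c0_coset I (sup x y)" (is "?L = ?R")
proof
  note S = subspace_c0[OF I]
  show "?L \<subseteq> ?R"
  proof
    fix u assume "u \<in> ?L"
    then obtain a b where ab: "a \<in> c0 I" "b \<in> c0 I" and u: "u = sup (x + a) (y + b)"
      by (auto simp: linf_quotient_def c0_coset_def)
    have "u - sup x y \<in> c0 I"
      using I ab by (rule c0_dominated[where C = 1]) (auto simp: u sup_real_def max_def)
    then show "u \<in> ?R" unfolding c0_coset_def
      by (auto intro!: exI[of _ "u - sup x y"])
  qed
  show "?R \<subseteq> ?L"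
  proof
    fix u assume "u \<in> ?R"
    then obtain a where a: "a \<in> c0 I" "u = sup x y + a"
      by (auto simp: c0_coset_def)
    have "u = sup (x + a) (y + a)"
      by (rule bcontfun_eqI) (simp add: a sup_real_def max_def)
    then show "u \<in> ?L" using a
      unfolding linf_quotient_def c0_coset_def by (simp, metis)
  qed
qed

lemma linf_quotient_norm:
  "vnorm (linf_quotient I) (c0_coset I x) = infdist x (c0 I)"
proof -
  note S = subspace_c0[OF I]
  have "norm ` c0_coset I x = dist x ` c0 I"
    unfolding c0_coset_def dist_norm image_def
    using subspace_neg[OF S] by (auto, (metis add_uminus_conv_diff diff_minus_eq_add)+)
  moreover have "c0 I \<noteq> {}" using subspace_0[OF S] by auto
  ultimately show ?thesis by (simp add: linf_quotient_def infdist_def)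
qed

end

end

theory Submission
  imports Defs
begin

text \<open>
  A maximal ideal \<open>M\<close> on \<open>\<nat>\<close> is the dual of an ultrafilter, along which every bounded sequence
  converges, and \<open>c0 M\<close> consists of the sequences with limit \<open>0\<close>. The limits along countably many
  maximal ideals \<open>M\<^sub>0, M\<^sub>1, \<dots>\<close> are the coordinates of a linear lattice homomorphism of \<open>\<ell>\<^sub>\<infinity>\<close> into itself,
  with kernel \<open>\<Inter>n. c0 M\<^sub>n = c0 (\<Inter>n. M\<^sub>n)\<close>. It induces the isomorphism of (2): its range is closed
  because truncating \<open>x\<close> at the norm of its image changes no limit, so that every element of the
  range has a preimage of no larger norm (\<open>closed_range_if_norm_lifting\<close>).

  Conversely, composing an isomorphism as in (2) with the quotient map yields an operator \<open>Q\<close> as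
  in (3), because \<open>\<chi>\<^bsub>A \<inter> B\<^esub>\<close> is the infimum of the positive elements \<open>\<chi>\<^sub>A\<close> and \<open>\<chi>\<^sub>B\<close>.

  From (3) to (1), fix a coordinate \<open>n\<close> and call \<open>B\<close> charged if \<open>Q (\<chi>\<^sub>B)\<close> does not vanish at \<open>n\<close>.
  Charged sets are closed under intersection by hypothesis, and if a charged set is cut in two, one of
  the pieces is charged by additivity. So the charged sets, if there are any, are a base of an
  ultrafilter, without an appeal to Zorn's lemma
  (\<open>maximal_ideal_disjoint_from_charged\<close>). The intersection of the dual maximal ideals is \<open>I\<close>: a set
  outside \<open>I\<close> is charged at some coordinate, whereas for \<open>A \<in> I\<close> no \<open>B \<inter> A\<close> is charged, so that
  \<open>B - A\<close> is charged whenever \<open>B\<close> is.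
\<close>

section \<open>Maximal ideals and limits along them\<close>

lemma maximal_set_ideal_dichotomy:
  assumes M: "maximal_set_ideal M"
  shows "A \<in> M \<or> - A \<in> M"
proof (rule disjCI)
  assume nA: "- A \<notin> M"
  have I: "set_ideal M" using M by (auto simp: maximal_set_ideal_def proper_ideal_def)
  \<comment> \<open>the ideal generated by \<open>M\<close> and \<open>A\<close>\<close>
  define J where "J = {D. \<exists>C\<in>M. D \<subseteq> A \<union> C}"
  have emp: "{} \<in> M" using I by (simp add: set_ideal_def)
  have MJ: "M \<subseteq> J" by (auto simp: J_def)
  have "set_ideal J"
    unfolding set_ideal_def
  proof (intro conjI ballI allI impI)
    show "{} \<in> J" using emp MJ by blast
    show "B \<in> J" if "C \<in> J" "B \<subseteq> C" for B C using that by (auto simp: J_def)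
    show "finite B \<Longrightarrow> B \<in> J" for B using I MJ by (auto simp: set_ideal_def)
    fix B C assume "B \<in> J" "C \<in> J"
    then obtain B' C' where *: "B' \<in> M" "C' \<in> M" "B \<subseteq> A \<union> B'" "C \<subseteq> A \<union> C'"
      by (auto simp: J_def)
    have "B' \<union> C' \<in> M" using I * by (auto simp: set_ideal_def)
    moreover have "B \<union> C \<subseteq> A \<union> (B' \<union> C')" using * by blast
    ultimately show "B \<union> C \<in> J" unfolding J_def by blast
  qed
  moreover have "J \<noteq> UNIV"
  proof
    assume "J = UNIV"
    then obtain C where "C \<in> M" "UNIV \<subseteq> A \<union> C" by (auto simp: J_def)
    then have "- A \<subseteq> C" "C \<in> M" by auto
    then show False using I nA by (auto simp: set_ideal_def)
  qed
  ultimately have "J = M" using M MJ by (auto simp: maximal_set_ideal_def)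
  moreover have "A \<in> J" using emp by (auto simp: J_def)
  ultimately show "A \<in> M" by simp
qed

definition ideal_filter :: "'a set set \<Rightarrow> 'a filter" where
  "ideal_filter I = Abs_filter (\<lambda>P. {x. \<not> P x} \<in> I)"

lemma eventually_ideal_filter:
  assumes I: "set_ideal I"
  shows "eventually P (ideal_filter I) \<longleftrightarrow> {x. \<not> P x} \<in> I"
  unfolding ideal_filter_def
proof (rule eventually_Abs_filter, unfold_locales)
  show "{x. \<not> True} \<in> I" using I by (simp add: set_ideal_def)
  fix P Q :: "'a \<Rightarrow> bool"
  show "{x. \<not> (P x \<and> Q x)} \<in> I" if "{x. \<not> P x} \<in> I" "{x. \<not> Q x} \<in> I"
  proof -
    have "{x. \<not> (P x \<and> Q x)} = {x. \<not> P x} \<union> {x. \<not> Q x}" by auto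
    then show ?thesis using I that by (simp add: set_ideal_def)
  qed
  show "{x. \<not> Q x} \<in> I" if "\<forall>x. P x \<longrightarrow> Q x" "{x. \<not> P x} \<in> I"
  proof -
    have "{x. \<not> Q x} \<subseteq> {x. \<not> P x}" using that by auto
    then show ?thesis using I that by (simp add: set_ideal_def)
  qed
qed

lemma c0_iff_tendsto:
  assumes "set_ideal I"
  shows "x \<in> c0 I \<longleftrightarrow> (apply_bcontfun x \<longlongrightarrow> 0) (ideal_filter I)"
  using assms by (simp add: c0_def tendsto_iff eventually_ideal_filter not_less)

lemma ideal_filter_neq_bot:
  assumes "proper_ideal I"
  shows "ideal_filter I \<noteq> bot"
proof
  have I: "set_ideal I" "I \<noteq> UNIV" using assms by (auto simp: proper_ideal_def)
  assume "ideal_filter I = bot"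
  then have "eventually (\<lambda>_. False) (ideal_filter I)" by simp
  then have "UNIV \<in> I" using I by (simp add: eventually_ideal_filter)
  then have "A \<in> I" for A using I by (auto simp: set_ideal_def)
  then show False using I by auto
qed

text \<open>
  By compactness, a sequence with values in a compact set has a cluster point along any proper
  filter; along an ultrafilter, a cluster point is a limit.
\<close>

lemma tendsto_Lim_maximal_ideal:
  fixes x :: linf
  assumes M: "maximal_set_ideal M"
  shows "(apply_bcontfun x \<longlongrightarrow> Lim (ideal_filter M) (apply_bcontfun x)) (ideal_filter M)"
proof -
  let ?F = "ideal_filter M" and ?x = "apply_bcontfun x"
  have I: "set_ideal M" and ne: "?F \<noteq> bot"
    using M ideal_filter_neq_bot by (auto simp: maximal_set_ideal_def proper_ideal_def)
  let ?K = "cball (0 :: real) (norm x)"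
  have "filtermap ?x ?F \<noteq> bot" using ne by (simp add: filtermap_bot_iff)
  moreover have "eventually (\<lambda>t. t \<in> ?K) (filtermap ?x ?F)"
    using norm_bounded[of x] by (simp add: eventually_filtermap)
  ultimately obtain r where r: "inf (nhds r) (filtermap ?x ?F) \<noteq> bot"
    using compact_cball[of 0 "norm x"] unfolding compact_filter by blast
  have "(?x \<longlongrightarrow> r) ?F"
  proof (rule tendstoI)
    fix e :: real assume e: "e > 0"
    show "eventually (\<lambda>n. dist (?x n) r < e) ?F"
    proof (rule ccontr)
      assume "\<not> eventually (\<lambda>n. dist (?x n) r < e) ?F"
      then have "- {n. \<not> dist (?x n) r < e} \<in> M"
        using maximal_set_ideal_dichotomy[OF M] I by (auto simp: eventually_ideal_filter)
      moreover have "- {n. \<not> dist (?x n) r < e} = {n. \<not> \<not> dist (?x n) r < e}" by auto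
      ultimately have "eventually (\<lambda>n. \<not> dist (?x n) r < e) ?F"
        using I by (simp add: eventually_ideal_filter)
      then have 1: "eventually (\<lambda>t. \<not> dist t r < e) (filtermap ?x ?F)"
        by (simp add: eventually_filtermap)
      have 2: "eventually (\<lambda>t. dist t r < e) (nhds r)"
        using e by (auto simp: eventually_nhds_metric)
      have "eventually (\<lambda>_. False) (inf (nhds r) (filtermap ?x ?F))"
        unfolding eventually_inf using 1 2 by blast
      then show False using r by (simp add: trivial_limit_def)
    qed
  qed
  with tendsto_Lim[OF ne this] show ?thesis by simp
qed

section \<open>The operator of limits along a sequence of maximal ideals\<close>

definition limits_along :: "(nat \<Rightarrow> nat set set) \<Rightarrow> linf \<Rightarrow> linf" where
  "limits_along M x = Bcontfun (\<lambda>n. Lim (ideal_filter (M n)) (apply_bcontfun x))"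

context
  fixes M :: "nat \<Rightarrow> nat set set"
  assumes M: "\<And>n. maximal_set_ideal (M n)"
begin

lemma ideal_M: "set_ideal (M n)"
  using M by (auto simp: maximal_set_ideal_def proper_ideal_def)

lemma ideal_filter_M_neq_bot: "ideal_filter (M n) \<noteq> bot"
  using M ideal_filter_neq_bot by (auto simp: maximal_set_ideal_def)

lemma abs_Lim_le_norm: "\<bar>Lim (ideal_filter (M n)) (apply_bcontfun x)\<bar> \<le> norm (x :: linf)"
proof -
  have "((\<lambda>k. \<bar>apply_bcontfun x k\<bar>) \<longlongrightarrow> \<bar>Lim (ideal_filter (M n)) (apply_bcontfun x)\<bar>)
      (ideal_filter (M n))"
    by (intro tendsto_rabs tendsto_Lim_maximal_ideal M)
  then show ?thesis
    by (rule tendsto_upperbound)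
      (use norm_bounded[of x] in \<open>auto simp: ideal_filter_M_neq_bot\<close>)
qed

lemma apply_limits_along:
  "apply_bcontfun (limits_along M x) n = Lim (ideal_filter (M n)) (apply_bcontfun x)"
proof -
  have "(\<lambda>n. Lim (ideal_filter (M n)) (apply_bcontfun x)) \<in> bcontfun"
    by (rule bcontfun_normI[where b = "norm x"]) (auto simp: abs_Lim_le_norm)
  then show ?thesis by (simp add: limits_along_def Bcontfun_inverse)
qed

lemma tendsto_limits_along:
  "(apply_bcontfun x \<longlongrightarrow> apply_bcontfun (limits_along M x) n) (ideal_filter (M n))"
  unfolding apply_limits_along by (rule tendsto_Lim_maximal_ideal[OF M])

lemma limits_along_eqI:
  assumes "\<And>n. (apply_bcontfun x \<longlongrightarrow> apply_bcontfun y n) (ideal_filter (M n))"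
  shows "limits_along M x = y"
  by (rule bcontfun_eqI) (metis assms tendsto_limits_along tendsto_unique ideal_filter_M_neq_bot)

lemma bounded_linear_limits_along: "bounded_linear (limits_along M)"
proof (rule bounded_linear_intro[where K = 1])
  show "limits_along M (x + y) = limits_along M x + limits_along M y" for x y
    by (rule limits_along_eqI) (simp add: tendsto_add tendsto_limits_along)
  show "limits_along M (c *\<^sub>R x) = c *\<^sub>R limits_along M x" for c x
    by (rule limits_along_eqI) (simp add: tendsto_mult tendsto_limits_along)
  show "norm (limits_along M x) \<le> norm x * 1" for x
    by (rule norm_bound) (simp add: apply_limits_along abs_Lim_le_norm)
qed

lemma limits_along_sup: "limits_along M (sup x y) = sup (limits_along M x) (limits_along M y)"
  by (rule limits_along_eqI) (simp add: sup_bcontfun.rep_eq tendsto_sup tendsto_limits_along)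

lemma ker_limits_along: "{x. limits_along M x = 0} = c0 (\<Inter>n. M n)"
proof -
  have "limits_along M x = 0 \<longleftrightarrow> (\<forall>n. x \<in> c0 (M n))" for x
  proof
    assume "limits_along M x = 0"
    then show "\<forall>n. x \<in> c0 (M n)"
      using tendsto_limits_along[of x] by (simp add: c0_iff_tendsto[OF ideal_M])
  next
    assume "\<forall>n. x \<in> c0 (M n)"
    then show "limits_along M x = 0"
      by (intro limits_along_eqI) (simp add: c0_iff_tendsto[OF ideal_M])
  qed
  then show ?thesis by (auto simp: c0_def)
qed

text \<open>
  The preimage is \<open>x\<close> truncated at height \<open>norm (limits_along M x)\<close>: truncation commutes with limits,
  and all the limits of \<open>x\<close> are within the truncation bounds.
\<close>

lemma limits_along_norm_lifting:
  "\<exists>y. limits_along M y = limits_along M x \<and> norm y \<le> norm (limits_along M x)"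
proof -
  define r where "r = norm (limits_along M x)"
  define y where "y = sup (const_bcontfun (- r)) (inf x (const_bcontfun r))"
  have r: "\<bar>apply_bcontfun (limits_along M x) n\<bar> \<le> r" for n
    using norm_bounded[of "limits_along M x" n] by (simp add: r_def)
  have "(apply_bcontfun y \<longlongrightarrow> sup (- r) (inf (apply_bcontfun (limits_along M x) n) r))
      (ideal_filter (M n))" for n
    unfolding y_def bcontfun_simps const_bcontfun.rep_eq
    by (intro tendsto_sup tendsto_inf tendsto_const tendsto_limits_along)
  moreover have "sup (- r) (inf (apply_bcontfun (limits_along M x) n) r)
      = apply_bcontfun (limits_along M x) n" for n
    using r[of n] by (auto simp: sup_real_def inf_real_def max_def min_def)
  ultimately have "limits_along M y = limits_along M x"
    by (intro limits_along_eqI) simp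
  moreover have "norm y \<le> r"
  proof (rule norm_bound)
    have "r \<ge> 0" by (simp add: r_def)
    then show "norm (apply_bcontfun y n) \<le> r" for n
      by (auto simp: y_def const_bcontfun.rep_eq sup_real_def inf_real_def max_def min_def)
  qed
  ultimately show ?thesis unfolding r_def by blast
qed

end

section \<open>Operators with closed range\<close>

text \<open>
  Cauchy sequences converge uniformly, and uniform limits of continuous functions are continuous
  on any topological space, in particular on the discrete space \<^typ>\<open>nat\<close>.
\<close>

instance bcontfun :: (topological_space, complete_space) complete_space
proof
  fix f :: "nat \<Rightarrow> 'a \<Rightarrow>\<^sub>C 'b"
  assume "Cauchy f"
  then obtain g where "uniform_limit UNIV f g sequentially"
    using uniformly_convergent_eq_cauchy[of "\<lambda>_. True" f]
    unfolding Cauchy_def uniform_limit_sequentially_iff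
    by (metis dist_fun_lt_imp_dist_val_lt)
  then obtain l where "f \<longlonglongrightarrow> l"
    using uniform_limit_bcontfunE sequentially_bot by metis
  then show "convergent f" by (rule convergentI)
qed

instance bcontfun :: (topological_space, banach) banach ..

text \<open>
  A limit of points of the range is the sum of a rapidly converging series of points of the range;
  lifting the terms without increase of norm gives a convergent series of preimages.
\<close>

lemma closed_range_if_norm_lifting:
  fixes Q :: "'a::banach \<Rightarrow> 'b::real_normed_vector"
  assumes Q: "bounded_linear Q"
    and lift: "\<And>x. \<exists>y. Q y = Q x \<and> norm y \<le> norm (Q x)"
  shows "closed (range Q)"
proof -
  interpret bounded_linear Q by (rule Q)
  have "l \<in> range Q" if l: "l \<in> closure (range Q)" for l
  proof -
    have "\<exists>x. dist (Q x) l < (1/2) ^ k" for k :: nat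
      using l[unfolded closure_approachable, rule_format, of "(1/2) ^ k"] by auto
    then obtain x where x: "\<And>k. dist (Q (x k)) l < (1/2) ^ k" by metis
    have "\<forall>k. \<exists>y. Q y = Q (x (Suc k) - x k) \<and> norm y \<le> norm (Q (x (Suc k) - x k))"
      using lift by (rule allI)
    from choice[OF this] obtain u where u: "\<And>k. Q (u k) = Q (x (Suc k) - x k)"
      and nu: "\<And>k. norm (u k) \<le> norm (Q (x (Suc k) - x k))"
      by blast
    have "norm (u k) \<le> 2 * (1/2) ^ k" for k
    proof -
      have "norm (u k) \<le> dist (Q (x (Suc k))) (Q (x k))"
        using nu[of k] by (simp add: diff dist_norm)
      also have "\<dots> \<le> dist (Q (x (Suc k))) l + dist (Q (x k)) l"
        by (rule dist_triangle2)
      also have "\<dots> \<le> (1/2) ^ Suc k + (1/2) ^ k"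
        using x[of k] x[of "Suc k"] by linarith
      also have "\<dots> \<le> 2 * (1/2) ^ k" by simp
      finally show ?thesis .
    qed
    moreover have "summable (\<lambda>k. 2 * (1/2 :: real) ^ k)"
      by (rule summable_mult[OF summable_geometric]) simp
    ultimately have "summable u"
      by (rule summable_comparison_test'[where N = 0, rotated])
    then have "(\<lambda>k. Q (u k)) sums Q (suminf u)" by (rule sums[OF summable_sums])
    moreover have "(\<lambda>k. Q (x k)) \<longlonglongrightarrow> l"
    proof (subst tendsto_dist_iff, rule Lim_null_comparison)
      show "(\<lambda>k. (1/2 :: real) ^ k) \<longlonglongrightarrow> 0" by (rule LIMSEQ_power_zero) simp
      show "\<forall>\<^sub>F k in sequentially. norm (dist (Q (x k)) l) \<le> (1/2) ^ k"
        using x by (auto intro!: always_eventually less_imp_le)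
    qed
    then have "(\<lambda>k. Q (u k)) sums (l - Q (x 0))"
      unfolding u diff by (rule telescope_sums)
    ultimately have "Q (suminf u) = l - Q (x 0)" by (rule sums_unique2)
    then have "l = Q (suminf u + x 0)" by (simp add: add)
    then show ?thesis by blast
  qed
  then have "closure (range Q) = range Q" using closure_subset by blast
  then show ?thesis by (simp only: closure_eq)
qed

section \<open>Lattice homomorphisms and the quotient\<close>

lemma inf_bcontfun_eq: "inf x y = x + y - sup x y" for x y :: linf
  by (rule bcontfun_eqI) (auto simp: sup_real_def inf_real_def)

lemma lattice_isomorphism_of_lattice_operator:
  fixes Q :: "linf \<Rightarrow> linf"
  assumes I: "set_ideal I"
    and Q: "bounded_linear Q"
    and ker: "{x. Q x = 0} = c0 I"
    and sup: "\<And>x y. Q (sup x y) = sup (Q x) (Q y)"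
    and lift: "\<And>x. \<exists>y. Q y = Q x \<and> norm y \<le> norm (Q x)"
  shows "\<exists>S T. closed_sublattice S \<and> lattice_isomorphism (linf_quotient I) (linf_on S) T"
proof (intro exI conjI)
  interpret bounded_linear Q by (rule Q)
  have inf: "Q (inf x y) = inf (Q x) (Q y)" for x y
    by (simp add: inf_bcontfun_eq add diff sup)
  show "closed_sublattice (range Q)"
    unfolding closed_sublattice_def
  proof (intro conjI ballI)
    show "subspace (range Q)" using linear_subspace_image[OF linear_axioms subspace_UNIV] .
    show "closed (range Q)" using Q lift by (rule closed_range_if_norm_lifting)
    fix x y assume "x \<in> range Q" "y \<in> range Q"
    then show "sup x y \<in> range Q" "inf x y \<in> range Q"
      by (auto simp flip: sup inf)
  qed
  define T where "T X = Q (inv (c0_coset I) X)" for X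
  have eq_iff: "c0_coset I x = c0_coset I y \<longleftrightarrow> Q x = Q y" for x y
    by (simp add: c0_coset_eq_iff[OF I] diff flip: ker)
  have T: "T (c0_coset I x) = Q x" for x
    unfolding T_def eq_iff[symmetric] by (rule f_inv_into_f) simp
  obtain K where K: "\<And>x. norm (Q x) \<le> norm x * K" "K \<ge> 0" using nonneg_bounded by blast
  have bound: "norm (Q x) \<le> K * infdist x (c0 I)" for x
  proof -
    have ne: "c0 I \<noteq> {}" using subspace_0[OF subspace_c0[OF I]] by auto
    have "norm (Q x) \<le> K * dist x z" if "z \<in> c0 I" for z
    proof -
      have "Q z = 0" using that ker by blast
      then have "norm (Q x) = norm (Q (x - z))" by (simp add: diff)
      also have "\<dots> \<le> K * dist x z" using K(1)[of "x - z"] by (simp add: dist_norm mult.commute)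
      finally show ?thesis .
    qed
    note le = this
    show ?thesis
    proof (cases "K = 0")
      case True
      then show ?thesis using K(1)[of x] by simp
    next
      case False
      then have "K > 0" using K by simp
      then have "norm (Q x) / K \<le> infdist x (c0 I)"
        unfolding infdist_notempty[OF ne]
        by (intro cINF_greatest[OF ne]) (use le in \<open>auto simp: field_simps\<close>)
      then show ?thesis using \<open>K > 0\<close> by (simp add: field_simps)
    qed
  qed
  have carrier: "vcarrier (linf_quotient I) = range (c0_coset I)"
    by (simp add: linf_quotient_def)
  show "lattice_isomorphism (linf_quotient I) (linf_on (range Q)) T"
    unfolding lattice_isomorphism_def lattice_homomorphism_def carrier
  proof (intro conjI)
    show "T \<in> range (c0_coset I) \<rightarrow> vcarrier (linf_on (range Q))"
      by (auto simp: T linf_on_def)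
    show "\<forall>x\<in>range (c0_coset I). \<forall>y\<in>range (c0_coset I).
        T (vadd (linf_quotient I) x y) = vadd (linf_on (range Q)) (T x) (T y)"
      by (auto simp: linf_quotient_add[OF I] T linf_on_def add)
    show "\<forall>c. \<forall>x\<in>range (c0_coset I).
        T (vscale (linf_quotient I) c x) = vscale (linf_on (range Q)) c (T x)"
      by (auto simp: linf_quotient_scale[OF I] T linf_on_def scaleR)
    show "\<forall>x\<in>range (c0_coset I). \<forall>y\<in>range (c0_coset I).
        T (vsup (linf_quotient I) x y) = vsup (linf_on (range Q)) (T x) (T y)"
      by (auto simp: linf_quotient_sup[OF I] T linf_on_def sup)
    show "\<exists>K. \<forall>x\<in>range (c0_coset I).
        vnorm (linf_on (range Q)) (T x) \<le> K * vnorm (linf_quotient I) x"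
      by (intro exI[of _ K]) (auto simp: linf_quotient_norm[OF I] T linf_on_def bound)
    show "bij_betw T (range (c0_coset I)) (vcarrier (linf_on (range Q)))"
      by (auto simp: bij_betw_def inj_on_def T eq_iff linf_on_def image_image)
  qed
qed

lemma lattice_operator_of_lattice_isomorphism:
  assumes I: "set_ideal I"
    and T: "lattice_isomorphism (linf_quotient I) (linf_on S) T"
  obtains Q :: "linf \<Rightarrow> linf" where "bounded_linear Q" "{x. Q x = 0} = c0 I"
    "\<And>x y. Q (sup x y) = sup (Q x) (Q y)"
proof
  define Q where "Q x = T (c0_coset I x)" for x
  have carrier: "vcarrier (linf_quotient I) = range (c0_coset I)"
    by (simp add: linf_quotient_def)
  note T' = T[unfolded lattice_isomorphism_def lattice_homomorphism_def carrier]
  have add: "Q (x + y) = Q x + Q y" for x y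
    using T' by (simp add: Q_def linf_on_def flip: linf_quotient_add[OF I])
  have scale: "Q (c *\<^sub>R x) = c *\<^sub>R Q x" for c x
    using T' by (simp add: Q_def linf_on_def flip: linf_quotient_scale[OF I])
  show "Q (sup x y) = sup (Q x) (Q y)" for x y
    using T' by (simp add: Q_def linf_on_def flip: linf_quotient_sup[OF I])
  obtain K where K: "\<And>x. norm (Q x) \<le> K * infdist x (c0 I)"
    using T' by (auto simp: Q_def linf_on_def linf_quotient_norm[OF I])
  show "bounded_linear Q"
  proof (rule bounded_linear_intro[where K = "\<bar>K\<bar>"])
    fix x
    have "norm (Q x) \<le> \<bar>K\<bar> * infdist x (c0 I)"
      by (rule order_trans[OF K]) (simp add: mult_right_mono infdist_nonneg)
    also have "\<dots> \<le> \<bar>K\<bar> * norm x"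
      using infdist_le[OF subspace_0[OF subspace_c0[OF I]], of x] by (simp add: mult_left_mono)
    finally show "norm (Q x) \<le> norm x * \<bar>K\<bar>" by (simp add: mult.commute)
  qed (rule add scale)+
  have "Q 0 = 0" using scale[of 0 0] by simp
  moreover have "Q x = Q y \<longleftrightarrow> c0_coset I x = c0_coset I y" for x y
    unfolding Q_def using T' by (metis bij_betw_imp_inj_on inj_on_contraD rangeI)
  ultimately have "Q x = 0 \<longleftrightarrow> x \<in> c0 I" for x
    using c0_coset_eq_iff[OF I, of x 0] by (metis diff_zero)
  then show "{x. Q x = 0} = c0 I" by blast
qed

section \<open>Characteristic functions\<close>

lemma chi_in_c0_iff:
  assumes I: "set_ideal I"
  shows "chi A \<in> c0 I \<longleftrightarrow> A \<in> I"
proof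
  assume "chi A \<in> c0 I"
  then have "{n. (1 :: real) \<le> \<bar>indicator A n\<bar>} \<in> I" by (auto simp: c0_def chi.rep_eq)
  moreover have "{n. (1 :: real) \<le> \<bar>indicator A n\<bar>} = A" by (auto simp: indicator_def)
  ultimately show "A \<in> I" by simp
next
  assume A: "A \<in> I"
  have "{n. e \<le> \<bar>indicator A n\<bar>} \<subseteq> A" if "e > 0" for e :: real
    using that by (auto simp: indicator_def split: if_splits)
  then show "chi A \<in> c0 I" using I A by (auto simp: c0_def chi.rep_eq set_ideal_def)
qed

lemma chi_empty: "chi {} = 0"
  by (rule bcontfun_eqI) (simp add: chi.rep_eq)

lemma chi_Int: "chi (A \<inter> B) = inf (chi A) (chi B)"
  by (rule bcontfun_eqI) (auto simp: chi.rep_eq indicator_def inf_real_def)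

lemma chi_sup_0: "sup (chi A) 0 = chi A"
  by (rule bcontfun_eqI) (auto simp: chi.rep_eq indicator_def sup_real_def)

lemma chi_split: "chi B = chi (B \<inter> A) + chi (B - A)"
  by (rule bcontfun_eqI) (auto simp: chi.rep_eq indicator_def)

lemma lattice_operator_chi_Int_neq_0:
  assumes Q: "bounded_linear Q" and sup: "\<And>x y. Q (sup x y) = sup (Q x) (Q y)"
    and A: "apply_bcontfun (Q (chi A)) n \<noteq> 0" and B: "apply_bcontfun (Q (chi B)) n \<noteq> 0"
  shows "apply_bcontfun (Q (chi (A \<inter> B)) :: linf) n \<noteq> (0 :: real)"
proof -
  interpret bounded_linear Q by (rule Q)
  have nonneg: "apply_bcontfun (Q (chi C)) n \<ge> 0" for C
  proof -
    have "Q (chi C) = sup (Q (chi C)) 0" by (metis chi_sup_0 sup zero)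
    then have "apply_bcontfun (Q (chi C)) n = sup (apply_bcontfun (Q (chi C)) n) 0"
      by (metis bcontfun_simps(1) zero_bcontfun.rep_eq)
    then show ?thesis by (metis sup.cobounded2)
  qed
  have "Q (chi (A \<inter> B)) = inf (Q (chi A)) (Q (chi B))"
    by (simp add: chi_Int inf_bcontfun_eq add diff sup)
  then show ?thesis
    using nonneg[of A] nonneg[of B] A B by (auto simp: inf_real_def min_def)
qed

section \<open>Maximal ideals from the coordinates of an operator\<close>

text \<open>
  \<open>F\<close> is the family of charged sets. The hypothesis \<open>split\<close> provides what maximality usually costs an
  appeal to Zorn's lemma: any \<open>A\<close> outside the ideal meets every member of \<open>F\<close> in a member of \<open>F\<close>,
  hence \<open>- A\<close> is in the ideal.
\<close>

lemma maximal_ideal_disjoint_from_charged: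
  assumes ne: "F \<noteq> {}" and emp: "{} \<notin> F"
    and Int: "\<And>A B. A \<in> F \<Longrightarrow> B \<in> F \<Longrightarrow> A \<inter> B \<in> F"
    and split: "\<And>A B. B \<in> F \<Longrightarrow> B \<inter> A \<in> F \<or> B - A \<in> F"
    and fin: "\<And>A. finite A \<Longrightarrow> A \<notin> F"
  shows "maximal_set_ideal {A. \<exists>B\<in>F. B \<inter> A = {}}" (is "maximal_set_ideal ?M")
  unfolding maximal_set_ideal_def proper_ideal_def
proof (intro conjI allI impI)
  obtain B\<^sub>0 where B\<^sub>0: "B\<^sub>0 \<in> F" using ne by blast
  show "set_ideal ?M"
    unfolding set_ideal_def
  proof (intro conjI ballI allI impI)
    show "{} \<in> ?M" using B\<^sub>0 by blast
    show "C \<in> ?M" if "A \<in> ?M" "C \<subseteq> A" for A C using that by blast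
    show "A \<union> C \<in> ?M" if AC: "A \<in> ?M" "C \<in> ?M" for A C
    proof -
      obtain B B' where "B \<in> F" "B' \<in> F" "B \<inter> A = {}" "B' \<inter> C = {}" using AC by blast
      then have "B \<inter> B' \<in> F" "(B \<inter> B') \<inter> (A \<union> C) = {}" using Int by blast+
      then show ?thesis by blast
    qed
    show "A \<in> ?M" if "finite A" for A
    proof -
      have "B\<^sub>0 - A \<in> F" using split[OF B\<^sub>0, of A] fin[of "B\<^sub>0 \<inter> A"] that by blast
      then show ?thesis by blast
    qed
  qed
  have "UNIV \<notin> ?M" using emp by auto
  then show "?M \<noteq> UNIV" by blast
  fix J assume J: "set_ideal J \<and> ?M \<subset> J"
  then obtain A where A: "A \<in> J" "A \<notin> ?M" by blast
  have "B\<^sub>0 - A \<notin> F" using A(2) by blast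
  then have "B\<^sub>0 \<inter> A \<in> F" using split[OF B\<^sub>0] by blast
  then have "- A \<in> ?M" by blast
  then have "A \<union> - A \<in> J" using J A(1) unfolding set_ideal_def by blast
  then have "UNIV \<in> J" by simp
  then have "C \<in> J" for C using J unfolding set_ideal_def by (meson subset_UNIV)
  then show "J = UNIV" by auto
qed

lemma at_most_omega_maximal_of_operator:
  fixes Q :: "linf \<Rightarrow> linf"
  assumes I: "proper_ideal I"
    and Q: "bounded_linear Q" and ker: "{x. Q x = 0} = c0 I"
    and Int: "\<And>A B n. apply_bcontfun (Q (chi A)) n \<noteq> 0 \<Longrightarrow> apply_bcontfun (Q (chi B)) n \<noteq> 0
      \<Longrightarrow> apply_bcontfun (Q (chi (A \<inter> B))) n \<noteq> 0"
  shows "at_most_omega_maximal I"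
proof -
  interpret bounded_linear Q by (rule Q)
  have set_I: "set_ideal I" and "I \<noteq> UNIV" using I by (auto simp: proper_ideal_def)
  define F where "F n = {A. apply_bcontfun (Q (chi A)) n \<noteq> 0}" for n
  define M where "M n = {A. \<exists>B\<in>F n. B \<inter> A = {}}" for n
  have I_iff: "A \<in> I \<longleftrightarrow> (\<forall>n. A \<notin> F n)" for A
  proof -
    have "A \<in> I \<longleftrightarrow> Q (chi A) = 0" using ker chi_in_c0_iff[OF set_I] by blast
    then show ?thesis by (auto simp: F_def intro: bcontfun_eqI)
  qed
  have split: "B \<inter> A \<in> F n \<or> B - A \<in> F n" if "B \<in> F n" for A B n
  proof -
    have "Q (chi B) = Q (chi (B \<inter> A)) + Q (chi (B - A))" using chi_split[of B A] add by metis
    then show ?thesis using that by (auto simp: F_def)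
  qed
  have max: "maximal_set_ideal (M n)" if "F n \<noteq> {}" for n
    unfolding M_def
  proof (rule maximal_ideal_disjoint_from_charged[OF that])
    show "{} \<notin> F n" by (simp add: F_def chi_empty zero)
    show "A \<inter> B \<in> F n" if "A \<in> F n" "B \<in> F n" for A B using that Int by (simp add: F_def)
    show "B \<inter> A \<in> F n \<or> B - A \<in> F n" if "B \<in> F n" for A B using that by (rule split)
    show "A \<notin> F n" if "finite A" for A
    proof -
      have "A \<in> I" using set_I that by (simp add: set_ideal_def)
      then show ?thesis using I_iff by blast
    qed
  qed
  define \<M> where "\<M> = M ` {n. F n \<noteq> {}}"
  have "\<M> \<noteq> {}"
    using I_iff \<open>I \<noteq> UNIV\<close> by (fastforce simp: \<M>_def)
  moreover have "countable \<M>" by (simp add: \<M>_def)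
  moreover have "\<forall>X\<in>\<M>. maximal_set_ideal X" using max by (auto simp: \<M>_def)
  moreover have "I = \<Inter>\<M>"
  proof (rule set_eqI)
    fix A
    show "A \<in> I \<longleftrightarrow> A \<in> \<Inter>\<M>"
    proof
      assume A: "A \<in> I"
      have "A \<in> M n" if ne: "F n \<noteq> {}" for n
      proof -
        obtain B where B: "B \<in> F n" using ne by blast
        have "B \<inter> A \<in> I" using A set_I unfolding set_ideal_def by (meson Int_lower2)
        then have "B - A \<in> F n" using split[OF B] I_iff by blast
        then show ?thesis by (auto simp: M_def)
      qed
      then show "A \<in> \<Inter>\<M>" by (auto simp: \<M>_def)
    next
      assume A: "A \<in> \<Inter>\<M>"
      have "A \<notin> F n" for n
      proof
        assume An: "A \<in> F n"
        then have "A \<in> M n" using A by (auto simp: \<M>_def)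
        then obtain B where "B \<in> F n" "B \<inter> A = {}" by (auto simp: M_def)
        then have "apply_bcontfun (Q (chi {})) n \<noteq> 0" using An Int[of B n A] by (simp add: F_def)
        then show False by (simp add: chi_empty zero)
      qed
      then show "A \<in> I" using I_iff by blast
    qed
  qed
  ultimately show ?thesis unfolding at_most_omega_maximal_def by blast
qed

section \<open>The equivalences\<close>

theorem theorem6p2:
  fixes I :: "nat set set"
  assumes "proper_ideal I"
  shows "(at_most_omega_maximal I \<longleftrightarrow>
          (\<exists>S T. closed_sublattice S \<and> lattice_isomorphism (linf_quotient I) (linf_on S) T)) \<and>
         (at_most_omega_maximal I \<longleftrightarrow>
          (\<exists>Q :: linf \<Rightarrow> linf.
             bounded_linear Q \<and> {x. Q x = 0} = c0 I \<and>
             (\<forall>A B n. apply_bcontfun (Q (chi A)) n \<noteq> 0 \<and> apply_bcontfun (Q (chi B)) n \<noteq> 0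
                \<longrightarrow> apply_bcontfun (Q (chi (A \<inter> B))) n \<noteq> 0)))"
    (is "(?P1 \<longleftrightarrow> ?P2) \<and> (?P1 \<longleftrightarrow> ?P3)")
proof -
  have I: "set_ideal I" using assms by (simp add: proper_ideal_def)
  have "?P2" if P1: ?P1
  proof -
    obtain \<M> where \<M>: "\<M> \<noteq> {}" "countable \<M>" "\<forall>M\<in>\<M>. maximal_set_ideal M" "I = \<Inter>\<M>"
      using P1 by (auto simp: at_most_omega_maximal_def)
    \<comment> \<open>an enumeration of the family, with repetitions if it is finite\<close>
    define M where "M = from_nat_into \<M>"
    have range: "range M = \<M>" unfolding M_def using \<M> by (intro range_from_nat_into)
    then have M: "maximal_set_ideal (M n)" for n using \<M>(3) by blast
    show ?P2
    proof (rule lattice_isomorphism_of_lattice_operator[OF I])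
      show "bounded_linear (limits_along M)" using M by (rule bounded_linear_limits_along)
      show "{x. limits_along M x = 0} = c0 I"
        using ker_limits_along[of M] M by (simp add: range \<M>(4))
      show "limits_along M (sup x y) = sup (limits_along M x) (limits_along M y)" for x y
        using M by (rule limits_along_sup)
      show "\<exists>y. limits_along M y = limits_along M x \<and> norm y \<le> norm (limits_along M x)" for x
        using M by (rule limits_along_norm_lifting)
    qed
  qed
  moreover have "?P3" if P2: ?P2
  proof -
    obtain S T where "lattice_isomorphism (linf_quotient I) (linf_on S) T" using P2 by blast
    then obtain Q :: "linf \<Rightarrow> linf" where "bounded_linear Q" "{x. Q x = 0} = c0 I"
      "\<And>x y. Q (sup x y) = sup (Q x) (Q y)"
      using lattice_operator_of_lattice_isomorphism[OF I] by blast
    then show ?P3 using lattice_operator_chi_Int_neq_0 by (intro exI[of _ Q]) auto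
  qed
  moreover have "?P1" if P3: ?P3
    using P3 at_most_omega_maximal_of_operator[OF assms] by blast
  ultimately show ?thesis by argo
qed

end
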